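(* For every $k\ge2$ and every $s\ge0$, $$R(k^2-1)\le |W_{k,s}|.$$
   Context: $\mathbb N=\{1,2,3,\dots\}$; $\tau(n)$ is the number of positive divisors of $n$; $T(n)=n+\tau(n)$, with iterates $T^s$. $\Gamma$ is the undirected graph with vertex set $\mathbb N$ and edge set $\{\{n,T(n)\}:n\in\mathbb N\}$, and $R(X)$ is the number of connected components of $\Gamma$ meeting $[1,X]$. For $k\ge1$ the annular transfer map $\mathcal A_k:\{0,1,\dots,2k\}\to\{0,1,\dots,2k+2\}$ is defined as follows: for $0\le r\le 2k$, let $s\ge1$ be minimal with $T^s(k^2+r)\ge (k+1)^2$; then $\mathcal A_k(r)=T^s(k^2+r)-(k+1)^2$. For a set $A$ of offsets, $\mathcal A_k(A)=\{\mathcal A_k(r):r\in A\}$. For $k\ge2$ the exit set is $$E_k=\{\tau(k^2-j)-j:\ 1\le j\le 2k-2,\ \tau(k^2-j)\ge j\}\subseteq\{0,\dots,2k\}.$$ The confluence widths sets are, for $k\ge2$, $$W_{k,0}=E_k,\qquad W_{k,s}=\mathcal A_{k+s-1}(W_{k,s-1})\quad(s\ge1);$$ one has $W_{k,s}\subseteq E_{k+s}$, so the recursion is well defined. *)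

theory Defs
  imports Main
begin

definition tau :: "nat \<Rightarrow> nat" where
  "tau n = card {d. d dvd n}"

definition T :: "nat \<Rightarrow> nat" where
  "T n = n + tau n"

text \<open>The graph Gamma. Its vertices are the positive integers, so the number 0 of type nat
  is not a vertex.\<close>

definition Gamma_verts :: "nat set" where
  "Gamma_verts = {1..}"

definition Gamma_edges :: "nat set set" where
  "Gamma_edges = {{n, T n} | n. n \<in> Gamma_verts}"

definition Gamma_connected :: "(nat \<times> nat) set" where
  "Gamma_connected = {(u, v). u \<in> Gamma_verts \<and> v \<in> Gamma_verts \<and>
     (u, v) \<in> {(x, y). {x, y} \<in> Gamma_edges}\<^sup>*}"

definition Gamma_components :: "nat set set" where
  "Gamma_components = Gamma_verts // Gamma_connected"

definition R :: "nat \<Rightarrow> nat" where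
  "R X = card {C \<in> Gamma_components. C \<inter> {1..X} \<noteq> {}}"

text \<open>The transfer map is only meaningful for \<open>k \<ge> 1\<close> and \<open>r \<le> 2 * k\<close>. There \<open>tau\<close> is positive
  along the orbit, so the required \<open>s\<close> exists and the final subtraction does not truncate.\<close>

definition transfer :: "nat \<Rightarrow> nat \<Rightarrow> nat" where
  "transfer k r =
     (let s = (LEAST s. 1 \<le> s \<and> (k + 1)\<^sup>2 \<le> (T ^^ s) (k\<^sup>2 + r))
      in (T ^^ s) (k\<^sup>2 + r) - (k + 1)\<^sup>2)"

text \<open>For \<open>k \<ge> 2\<close> and \<open>j \<le> 2 * k - 2\<close> one has \<open>j < k\<^sup>2\<close>, so no subtraction truncates.\<close>

definition exit_set :: "nat \<Rightarrow> nat set" where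
  "exit_set k = {tau (k\<^sup>2 - j) - j | j. 1 \<le> j \<and> j \<le> 2 * k - 2 \<and> j \<le> tau (k\<^sup>2 - j)}"

fun W :: "nat \<Rightarrow> nat \<Rightarrow> nat set" where
  "W k 0 = exit_set k"
| "W k (Suc s) = transfer (k + s) ` W k s"

end

theory Submission
  imports Defs
begin

text \<open>
  On positive integers \<^term>\<open>T\<close> is strictly increasing along orbits, so every \<open>n < k\<^sup>2\<close> eventually
  reaches or passes \<open>k\<^sup>2\<close>. If \<open>k\<^sup>2 - j\<close> is the last point of its orbit below \<open>k\<^sup>2\<close>, then
  \<open>j \<le> tau (k\<^sup>2 - j) \<le> 2 * k - 2\<close>: the first inequality says that the next step reaches \<open>k\<^sup>2\<close>, the
  second pairs each divisor with its complementary divisor, one of which is below \<open>k\<close>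
  (\<open>tau_less_square\<close>). Hence the landing point is \<open>k\<^sup>2 + r\<close> with \<open>r\<close> in the exit set. The transfer map
  only follows the orbit further, up to its first point beyond the next square, so it stays in the
  same component. Every component meeting \<open>[1, k\<^sup>2 - 1]\<close> thus contains a point \<open>(k + s)\<^sup>2 + w\<close>
  with \<open>w\<close> in \<^term>\<open>W k s\<close> (\<open>connected_to_width_set\<close>). Distinct components are disjoint, so there are
  at most as many of them as elements of \<^term>\<open>W k s\<close>.
\<close>

lemma tau_pos:
  assumes "1 \<le> n"
  shows "1 \<le> tau n"
proof -
  have "finite {d. d dvd n}" "1 \<in> {d. d dvd n}"
    using assms by auto
  then show ?thesis
    unfolding tau_def by (metis One_nat_def Suc_leI card_gt_0_iff empty_iff)
qed

text \<open>Of two complementary divisors of a number below \<open>k\<^sup>2\<close>, one is below \<open>k\<close> and determines the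
  other.\<close>

lemma tau_less_square:
  assumes "1 \<le> m" and "m < k\<^sup>2"
  shows "tau m \<le> 2 * k - 2"
proof -
  let ?S = "{1..k - 1}"
  have "{d. d dvd m} \<subseteq> ?S \<union> (\<lambda>d. m div d) ` ?S"
  proof
    fix d assume "d \<in> {d. d dvd m}"
    then obtain e where e: "m = d * e" by auto
    with assms(1) have pos: "1 \<le> d" "1 \<le> e" by auto
    show "d \<in> ?S \<union> (\<lambda>d. m div d) ` ?S"
    proof (cases "d < k")
      case True
      with pos show ?thesis by auto
    next
      case False
      have "e < k"
      proof (rule ccontr)
        assume "\<not> e < k"
        with False have "k * k \<le> d * e" by (intro mult_le_mono) auto
        with assms(2) e show False by (simp add: power2_eq_square)
      qed
      with pos have "e \<in> ?S" by auto
      moreover have "d = m div e" using e pos by simp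
      ultimately show ?thesis by blast
    qed
  qed
  then have "tau m \<le> card (?S \<union> (\<lambda>d. m div d) ` ?S)"
    unfolding tau_def by (intro card_mono) auto
  also have "\<dots> \<le> card ?S + card ((\<lambda>d. m div d) ` ?S)"
    by (rule card_Un_le)
  also have "\<dots> \<le> card ?S + card ?S"
    by (intro add_left_mono card_image_le) simp
  finally show ?thesis by simp
qed

lemma T_iterate_ge:
  assumes "1 \<le> n"
  shows "n + i \<le> (T ^^ i) n"
proof (induction i)
  case (Suc i)
  with assms have "1 \<le> (T ^^ i) n" by linarith
  from tau_pos[OF this] Suc show ?case by (simp add: T_def[of "(T ^^ i) n"])
qed simp

lemma orbit_crosses:
  assumes "1 \<le> n" and "n < N"
  obtains i where "(T ^^ i) n < N" and "N \<le> T ((T ^^ i) n)"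
proof -
  let ?P = "\<lambda>i. N \<le> (T ^^ i) n"
  have "?P N" using T_iterate_ge[OF assms(1), of N] by linarith
  moreover have "\<not> ?P 0" using assms(2) by simp
  ultimately obtain i where "\<not> ?P i" "?P (Suc i)"
    using ex_least_nat_less[of ?P N] by blast
  then show thesis by (intro that[of i]) simp_all
qed

lemma equiv_Gamma_connected: "equiv Gamma_verts Gamma_connected"
proof -
  let ?E = "{(x, y). {x, y} \<in> Gamma_edges}"
  have "sym ?E" by (auto simp: sym_def insert_commute)
  then have "sym (?E\<^sup>*)" by (rule sym_rtrancl)
  then show ?thesis
    unfolding Gamma_connected_def
    by (intro equivI refl_onI symI transI) (auto dest: symD)
qed

lemma T_iterate_connected:
  assumes "1 \<le> n"
  shows "(n, (T ^^ i) n) \<in> Gamma_connected"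
proof (induction i)
  case 0
  with assms show ?case by (simp add: Gamma_connected_def Gamma_verts_def)
next
  case (Suc i)
  have "1 \<le> (T ^^ i) n" "1 \<le> (T ^^ Suc i) n"
    using assms T_iterate_ge[OF assms, of i] T_iterate_ge[OF assms, of "Suc i"] by linarith+
  then have "((T ^^ i) n, (T ^^ Suc i) n) \<in> Gamma_connected"
    by (auto simp: Gamma_connected_def Gamma_edges_def Gamma_verts_def intro!: r_into_rtrancl)
  with Suc show ?case
    using equiv_Gamma_connected by (meson equivE transD)
qed

lemma connected_to_exit:
  assumes "1 \<le> n" and "n < k\<^sup>2"
  shows "\<exists>r \<in> exit_set k. (n, k\<^sup>2 + r) \<in> Gamma_connected"
proof -
  obtain i where i: "(T ^^ i) n < k\<^sup>2" "k\<^sup>2 \<le> T ((T ^^ i) n)"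
    using orbit_crosses[OF assms] .
  define m where "m = (T ^^ i) n"
  define j where "j = k\<^sup>2 - m"
  have m: "1 \<le> m"
    using T_iterate_ge[OF assms(1), of i] assms(1) by (simp add: m_def)
  have mj: "k\<^sup>2 - j = m" and j1: "1 \<le> j" and jt: "j \<le> tau m"
    using i by (auto simp: j_def m_def T_def)
  have "j \<le> 2 * k - 2"
    using jt tau_less_square[OF m, of k] i(1) by (simp add: m_def)
  with j1 jt mj have "tau m - j \<in> exit_set k"
    unfolding exit_set_def by (intro CollectI exI[of _ j]) simp
  moreover have "k\<^sup>2 + (tau m - j) = (T ^^ Suc i) n"
    using i by (simp add: j_def m_def T_def)
  ultimately show ?thesis
    using T_iterate_connected[OF assms(1), of "Suc i"] by metis
qed

text \<open>The least index in the definition of the transfer map exists because orbits are unbounded, so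
  the truncated subtraction there is exact, and the transfer returns a later point of the orbit.\<close>

lemma transfer_connected:
  assumes "1 \<le> k"
  shows "(k\<^sup>2 + r, (k + 1)\<^sup>2 + transfer k r) \<in> Gamma_connected"
proof -
  let ?n = "k\<^sup>2 + r"
  let ?P = "\<lambda>s. 1 \<le> s \<and> (k + 1)\<^sup>2 \<le> (T ^^ s) ?n"
  have n: "1 \<le> ?n" using assms by (simp add: Suc_leI)
  have "?P ((k + 1)\<^sup>2)"
    using T_iterate_ge[OF n, of "(k + 1)\<^sup>2"] by simp
  then have "?P (LEAST s. ?P s)" by (rule LeastI)
  then have "(k + 1)\<^sup>2 + transfer k r = (T ^^ (LEAST s. ?P s)) ?n"
    by (simp add: transfer_def)
  with T_iterate_connected[OF n] show ?thesis by metis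
qed

lemma connected_to_width_set:
  assumes "1 \<le> n" and "n < k\<^sup>2"
  shows "\<exists>w \<in> W k s. (n, (k + s)\<^sup>2 + w) \<in> Gamma_connected"
proof (induction s)
  case 0
  show ?case using connected_to_exit[OF assms] by simp
next
  case (Suc s)
  then obtain w where w: "w \<in> W k s" "(n, (k + s)\<^sup>2 + w) \<in> Gamma_connected" by blast
  have "1 \<le> k + s" using assms by (cases k) auto
  from transfer_connected[OF this] w(2)
  have "(n, (k + s + 1)\<^sup>2 + transfer (k + s) w) \<in> Gamma_connected"
    using equiv_Gamma_connected by (meson equivE transD)
  with w(1) show ?case by auto
qed

lemma finite_W: "finite (W k s)"
proof (induction s)
  case 0
  have "exit_set k \<subseteq> (\<lambda>j. tau (k\<^sup>2 - j) - j) ` {1..2 * k - 2}"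
    unfolding exit_set_def by auto
  then show ?case by (auto intro: finite_subset)
qed simp

theorem proposition5p8:
  fixes k s :: nat
  assumes "2 \<le> k"
  shows "R (k\<^sup>2 - 1) \<le> card (W k s)"
proof -
  let ?f = "\<lambda>w. Gamma_connected `` {(k + s)\<^sup>2 + w}"
  have "{C \<in> Gamma_components. C \<inter> {1..k\<^sup>2 - 1} \<noteq> {}} \<subseteq> ?f ` W k s"
  proof
    fix C assume "C \<in> {C \<in> Gamma_components. C \<inter> {1..k\<^sup>2 - 1} \<noteq> {}}"
    then obtain n where C: "C \<in> Gamma_verts // Gamma_connected" and nC: "n \<in> C"
      and n: "1 \<le> n" "n \<le> k\<^sup>2 - 1"
      unfolding Gamma_components_def by auto
    then have "n < k\<^sup>2" by linarith
    then obtain w where w: "w \<in> W k s" "(n, (k + s)\<^sup>2 + w) \<in> Gamma_connected"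
      using connected_to_width_set[OF n(1)] by blast
    have "C = Gamma_connected `` {n}"
      using C nC equiv_Gamma_connected
      by (metis Image_singleton_iff equiv_class_eq quotientE)
    also have "\<dots> = ?f w"
      using w(2) by (rule equiv_class_eq[OF equiv_Gamma_connected])
    finally show "C \<in> ?f ` W k s" using w(1) by blast
  qed
  then have "R (k\<^sup>2 - 1) \<le> card (?f ` W k s)"
    unfolding R_def by (intro card_mono) (simp_all add: finite_W)
  also have "\<dots> \<le> card (W k s)"
    by (rule card_image_le[OF finite_W])
  finally show ?thesis .
qed

end
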